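(* For every odd $n\geq 5$, there exists a subset $S\subseteq\mathrm{SL}_n(5)=\mathrm{PSL}_n(5)$ that is normal (invariant under conjugation by $\mathrm{SL}_n(5)$) and inverse-closed ($S=S^{-1}$), such that $|S|\geq|\mathrm{SL}_n(5)|/960$, but $\operatorname{diag}(1,-I_{n-1})\notin S^2$, where $S^2=\{ab:a,b\in S\}$.
   Context: $\operatorname{diag}(1,-I_{n-1})$ is the $n\times n$ diagonal matrix over $\mathbb{F}_5$ with one diagonal entry $1$ followed by $n-1$ diagonal entries $-1$. For odd $n$ the center of $\mathrm{SL}_n(5)$ is trivial, so $\mathrm{SL}_n(5)=\mathrm{PSL}_n(5)$. *)

theory Defs
  imports "Jordan_Normal_Form.Determinant" "HOL-Algebra.Coset" "HOL-Library.Cardinality"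
begin

text \<open>The field with \<open>q\<close> elements is represented by an arbitrary type \<open>'a\<close> of class \<open>field\<close> with
  \<open>CARD('a) = q\<close>; it is unique up to isomorphism.\<close>

definition SL :: "nat \<Rightarrow> 'a::field mat monoid" where
  "SL n = \<lparr>carrier = {A \<in> carrier_mat n n. det A = 1}, mult = (*), one = 1\<^sub>m n\<rparr>"

lemma group_SL: "group (SL n :: 'a::field mat monoid)"
proof (rule groupI)
  fix A :: "'a mat"
  assume "A \<in> carrier (SL n)"
  then have A: "A \<in> carrier_mat n n" "det A = 1"
    by (auto simp: SL_def)
  have adj: "adj_mat A \<in> carrier_mat n n" "adj_mat A * A = 1\<^sub>m n"
    using adj_mat[OF A(1)] A(2) by auto
  then have "det (adj_mat A) = 1"
    using det_mult[OF adj(1) A(1)] A(2) by simp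
  then show "\<exists>B\<in>carrier (SL n). B \<otimes>\<^bsub>SL n\<^esub> A = \<one>\<^bsub>SL n\<^esub>"
    using adj by (auto simp: SL_def intro!: bexI[of _ "adj_mat A"])
qed (auto simp: SL_def det_mult assoc_mult_mat)

definition group_center :: "('a, 'b) monoid_scheme \<Rightarrow> 'a set" where
  "group_center G = {z \<in> carrier G. \<forall>g\<in>carrier G. g \<otimes>\<^bsub>G\<^esub> z = z \<otimes>\<^bsub>G\<^esub> g}"

definition PSL :: "nat \<Rightarrow> 'a::field mat set monoid" where
  "PSL n = SL n Mod group_center (SL n)"

definition conj_invariant :: "('a, 'b) monoid_scheme \<Rightarrow> 'a set \<Rightarrow> bool" where
  "conj_invariant G S \<longleftrightarrow> (\<forall>g\<in>carrier G. \<forall>s\<in>S. g \<otimes>\<^bsub>G\<^esub> s \<otimes>\<^bsub>G\<^esub> inv\<^bsub>G\<^esub> g \<in> S)"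

end

theory Submission
  imports Defs
begin

text \<open>
  The set consists of the matrices that fix a plane pointwise and do not have the eigenvalue \<open>-1\<close>.
  If \<open>d = diag(1, -1, ..., -1)\<close> were a product \<open>a b\<close> of two of them, then the plane fixed by \<open>b\<close>
  would contain a vector \<open>z \<noteq> 0\<close> with first coordinate 0, and \<open>a z = a b z = d z = -z\<close>.

  The size is estimated by a second order Bonferroni argument. Call the first \<open>k\<close> columns of a matrix
  in \<open>SL n\<close> a \<open>k\<close>-frame. Since \<open>SL n\<close> acts transitively on \<open>k\<close>-frames, for every map \<open>\<phi>\<close> of the set of
  \<open>k\<close>-frames to itself the average number of frames \<open>s\<close> with \<open>a s = \<phi> s\<close> is 1. Let \<open>N\<^sub>2\<close>, \<open>N\<^sub>3\<close> count the
  fixed 2-frames and 3-frames of \<open>a\<close>, and \<open>M\<close> the 3-frames that \<open>a\<close> maps from \<open>(u, v, w)\<close> to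
  \<open>(u, v, -w)\<close>. The indicator of the set is at least \<open>N\<^sub>2 / 480 - N\<^sub>3 / 1920 - M / 1920\<close>, which has
  average \<open>1 / 960\<close>.
\<close>

section \<open>Averaging over a transitive action, and the quotient by the trivial subgroup\<close>

text \<open>Count the pairs \<open>(g, x)\<close> with \<open>act g x = \<phi> x\<close> by
  \<open>x\<close> instead of by \<open>g\<close>. If \<open>h\<close> maps \<open>y\<close> to
  \<open>z\<close>, left multiplication by \<open>h\<close> injects the elements taking
  \<open>x\<close> to \<open>y\<close> into those taking \<open>x\<close> to \<open>z\<close>. So by
  transitivity all these sets have size |G|/|X|, wherever \<open>\<phi>\<close> sends
  \<open>x\<close>. For the identity map this is Burnside's lemma with one orbit.\<close>

lemma (in group) sum_card_transporter:
  fixes act :: "'a \<Rightarrow> 'x \<Rightarrow> 'x"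
  assumes fin: "finite (carrier G)"
    and closed: "\<And>g x. g \<in> carrier G \<Longrightarrow> x \<in> X \<Longrightarrow> act g x \<in> X"
    and act_mult: "\<And>g h x. g \<in> carrier G \<Longrightarrow> h \<in> carrier G \<Longrightarrow> x \<in> X
      \<Longrightarrow> act (g \<otimes> h) x = act g (act h x)"
    and trans: "\<And>x y. x \<in> X \<Longrightarrow> y \<in> X \<Longrightarrow> \<exists>g\<in>carrier G. act g x = y"
    and ne: "X \<noteq> {}"
    and phi: "\<And>x. x \<in> X \<Longrightarrow> \<phi> x \<in> X"
  shows "(\<Sum>g\<in>carrier G. card {x\<in>X. act g x = \<phi> x}) = card (carrier G)"
proof -
  let ?T = "\<lambda>x y. {g \<in> carrier G. act g x = y}"
  obtain x0 where x0: "x0 \<in> X" using ne by auto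
  have "X \<subseteq> (\<lambda>g. act g x0) ` carrier G"
    using trans[OF x0] by auto
  then have finX: "finite X"
    using fin finite_surj by blast
  have le: "card (?T x y) \<le> card (?T x z)" if x: "x \<in> X" and y: "y \<in> X" and z: "z \<in> X" for x y z
  proof -
    obtain h where h: "h \<in> carrier G" "act h y = z" using trans[OF y z] by auto
    show ?thesis
    proof (rule card_inj_on_le[of "(\<otimes>) h"])
      show "inj_on ((\<otimes>) h) (?T x y)"
        using h by (auto simp: inj_on_def)
      show "(\<otimes>) h ` ?T x y \<subseteq> ?T x z"
        using h x act_mult by auto
      show "finite (?T x z)" using fin by auto
    qed
  qed
  have eq: "card (carrier G) = card X * card (?T x (\<phi> x))" if x: "x \<in> X" for x
  proof -
    have "carrier G = (\<Union>y\<in>X. ?T x y)" using closed x by auto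
    then have "card (carrier G) = card (\<Union>y\<in>X. ?T x y)" by simp
    also have "\<dots> = (\<Sum>y\<in>X. card (?T x y))"
      by (rule card_UN_disjoint) (use finX fin in auto)
    also have "\<dots> = (\<Sum>y\<in>X. card (?T x (\<phi> x)))"
      by (rule sum.cong) (auto intro!: antisym le x phi)
    finally show ?thesis by simp
  qed
  have card_eq: "card {x\<in>X. P x} = (\<Sum>x\<in>X. if P x then 1 else 0)" for P
    using finX by (simp add: sum.If_cases Int_def)
  have card_eq': "card {x\<in>carrier G. P x} = (\<Sum>x\<in>carrier G. if P x then 1 else 0)" for P
    using fin by (simp add: sum.If_cases Int_def)
  have "(\<Sum>g\<in>carrier G. card {x\<in>X. act g x = \<phi> x}) = (\<Sum>x\<in>X. card (?T x (\<phi> x)))"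
    unfolding card_eq card_eq' by (rule sum.swap)
  also have "\<dots> = (\<Sum>x\<in>X. card (carrier G) div card X)"
  proof (rule sum.cong)
    fix x assume "x \<in> X"
    then have "card (carrier G) = card X * card (?T x (\<phi> x))" "card X \<noteq> 0"
      using eq finX by auto
    then show "card (?T x (\<phi> x)) = card (carrier G) div card X" by simp
  qed simp
  also have "\<dots> = card X * (card (carrier G) div card X)" by simp
  also have "\<dots> = card (carrier G)" using eq[OF x0] by simp
  finally show "(\<Sum>g\<in>carrier G. card {x\<in>X. act g x = \<phi> x}) = card (carrier G)" .
qed

lemma (in group) trivial_quotient_iso: "(#>) {\<one>} \<in> iso G (G Mod {\<one>})"
proof -
  have n: "{\<one>} \<lhd> G" by (rule one_is_normal)
  show ?thesis
  proof (rule isoI)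
    show "(#>) {\<one>} \<in> hom G (G Mod {\<one>})"
      using normal.r_coset_hom_Mod[OF n] by simp
    show "bij_betw ((#>) {\<one>}) (carrier G) (carrier (G Mod {\<one>}))"
      by (auto simp: bij_betw_def inj_on_def FactGroup_def RCOSETS_def r_coset_def)
  qed
qed

section \<open>Finiteness, and arithmetic in a finite field\<close>

lemma finite_carrier_vec:
  assumes "finite (UNIV :: 'a set)"
  shows "finite (carrier_vec n :: 'a vec set)"
proof -
  have "inj_on list_of_vec (carrier_vec n :: 'a vec set)"
    by (auto simp: inj_on_def) (metis vec_list)
  moreover have "list_of_vec ` (carrier_vec n :: 'a vec set) \<subseteq> {xs. set xs \<subseteq> UNIV \<and> length xs = n}"
    by auto
  ultimately show ?thesis
    using finite_lists_length_eq[OF assms] by (meson finite_imageD finite_subset)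
qed

lemma finite_carrier_mat:
  assumes "finite (UNIV :: 'a set)"
  shows "finite (carrier_mat n m :: 'a mat set)"
proof -
  have "inj_on (\<lambda>A. map (row A) [0..<n]) (carrier_mat n m :: 'a mat set)"
    by (auto simp: inj_on_def intro!: eq_rowI)
  moreover have "(\<lambda>A. map (row A) [0..<n]) ` (carrier_mat n m :: 'a mat set)
      \<subseteq> {xs. set xs \<subseteq> carrier_vec m \<and> length xs = n}"
    by auto
  ultimately show ?thesis
    using finite_lists_length_eq[OF finite_carrier_vec[OF assms]] by (meson finite_imageD finite_subset)
qed

text \<open>Translation by 1 permutes the field, so the sum of all elements does not change when 1
  is added to each. For an infinite type \<open>CARD('a)\<close> is 0 by convention.\<close>

lemma of_nat_CARD: "(of_nat CARD('a) :: 'a::field) = 0"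
proof (cases "finite (UNIV :: 'a set)")
  case True
  have "(\<Sum>x\<in>(UNIV::'a set). x) = (\<Sum>x\<in>UNIV. x + 1)"
    by (rule sum.reindex_bij_witness[of _ "\<lambda>x. x + 1" "\<lambda>x. x - 1"]) auto
  then show ?thesis by (simp add: sum.distrib)
qed simp

text \<open>Multiplication by \<open>x\<close> permutes the nonzero elements; compare their product
  before and after.\<close>

lemma field_power_CARD:
  assumes "finite (UNIV :: 'a::field set)" and "(x::'a) \<noteq> 0"
  shows "x ^ (CARD('a) - 1) = 1"
proof -
  have "(\<Prod>y\<in>UNIV-{0::'a}. y) = (\<Prod>y\<in>UNIV-{0}. x * y)"
    by (rule prod.reindex_bij_witness[of _ "\<lambda>y. x * y" "\<lambda>y. y / x"]) (use assms in auto)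
  also have "\<dots> = x ^ (CARD('a) - 1) * (\<Prod>y\<in>UNIV-{0::'a}. y)"
    by (simp add: prod.distrib card_Diff_singleton)
  finally show ?thesis using assms by (simp add: prod_zero_iff)
qed

section \<open>Transvections and the action of SL on vectors\<close>

text \<open>The identity plus the rank-one matrix with \<open>x\<close> in column \<open>k\<close>.
  It is a transvection in the usual sense when \<open>x $ k = 0\<close>.\<close>

definition transvection :: "'a::field vec \<Rightarrow> nat \<Rightarrow> 'a mat" where
  "transvection x k = mat (dim_vec x) (dim_vec x)
    (\<lambda>(i, j). (if i = j then 1 else 0) + (if j = k then x $ i else 0))"

text \<open>As \<open>x $ k = 0\<close>, row \<open>k\<close> is that of the identity, and deleting
  row and column \<open>k\<close> leaves an identity matrix. Expand the determinant along row
  \<open>k\<close>.\<close>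

lemma transvection_SL:
  assumes "x \<in> carrier_vec n" "k < n" "x $ k = 0"
  shows "transvection x k \<in> carrier (SL n)"
proof -
  let ?A = "transvection x k"
  have A: "?A \<in> carrier_mat n n" using assms by (simp add: transvection_def)
  have del: "mat_delete ?A k k = 1\<^sub>m (n - 1)"
    using assms by (intro eq_matI) (auto simp: mat_delete_def transvection_def)
  have "det ?A = (\<Sum>j<n. ?A $$ (k, j) * cofactor ?A k j)"
    by (rule laplace_expansion_row[OF A \<open>k < n\<close>])
  also have "\<dots> = (\<Sum>j<n. if j = k then cofactor ?A k k else 0)"
    by (rule sum.cong) (use assms in \<open>auto simp: transvection_def\<close>)
  also have "\<dots> = 1"
    using assms(2) by (simp add: cofactor_def del)
  finally show ?thesis using A by (simp add: SL_def)
qed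

lemma transvection_mult_vec:
  assumes "x \<in> carrier_vec n" "y \<in> carrier_vec n" "k < n"
  shows "transvection x k *\<^sub>v y = y + y $ k \<cdot>\<^sub>v x"
proof (rule eq_vecI)
  fix i assume "i < dim_vec (y + y $ k \<cdot>\<^sub>v x)"
  then have i: "i < n" using assms by simp
  have "(transvection x k *\<^sub>v y) $ i
      = (\<Sum>j\<in>{0..<n}. (if j = i then y $ i else 0) + (if j = k then x $ i * y $ k else 0))"
    using assms i by (auto simp: transvection_def scalar_prod_def algebra_simps intro!: sum.cong)
  also have "\<dots> = (y + y $ k \<cdot>\<^sub>v x) $ i"
    using assms i by (simp add: sum.distrib)
  finally show "(transvection x k *\<^sub>v y) $ i = (y + y $ k \<cdot>\<^sub>v x) $ i" .
qed (use assms in \<open>simp add: transvection_def\<close>)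

lemma SL_carrierD:
  assumes "g \<in> carrier (SL n)"
  shows "g \<in> carrier_mat n n" "det g = 1"
  using assms by (auto simp: SL_def)

lemma mult_SL: "g \<otimes>\<^bsub>SL n\<^esub> h = g * h"
  by (simp add: SL_def)

lemma SL_mult_vec:
  assumes "g \<in> carrier (SL n)" "h \<in> carrier (SL n)" "v \<in> carrier_vec n"
  shows "(g * h) *\<^sub>v v = g *\<^sub>v (h *\<^sub>v v)"
  using assms by (intro assoc_mult_mat_vec) (auto dest: SL_carrierD)

lemma SL_inv:
  assumes "(g :: 'a::field mat) \<in> carrier (SL n)"
  shows "inv\<^bsub>SL n\<^esub> g \<in> carrier (SL n)"
    and "v \<in> carrier_vec n \<Longrightarrow> inv\<^bsub>SL n\<^esub> g *\<^sub>v (g *\<^sub>v v) = v"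
    and "v \<in> carrier_vec n \<Longrightarrow> g *\<^sub>v (inv\<^bsub>SL n\<^esub> g *\<^sub>v v) = v"
proof -
  interpret group "SL n :: 'a mat monoid" by (rule group_SL)
  show i: "inv\<^bsub>SL n\<^esub> g \<in> carrier (SL n)" using assms by simp
  have "inv\<^bsub>SL n\<^esub> g * g = 1\<^sub>m n" "g * inv\<^bsub>SL n\<^esub> g = 1\<^sub>m n"
    using l_inv[OF assms] r_inv[OF assms] by (auto simp: SL_def)
  then show "v \<in> carrier_vec n \<Longrightarrow> inv\<^bsub>SL n\<^esub> g *\<^sub>v (g *\<^sub>v v) = v"
    "v \<in> carrier_vec n \<Longrightarrow> g *\<^sub>v (inv\<^bsub>SL n\<^esub> g *\<^sub>v v) = v"
    using SL_mult_vec[OF i assms] SL_mult_vec[OF assms i] by auto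
qed

lemma SL_mult_vec_carrier[simp]:
  assumes "g \<in> carrier (SL n)" "v \<in> carrier_vec n"
  shows "g *\<^sub>v v \<in> carrier_vec n"
  using assms SL_carrierD mult_mat_vec_carrier by blast

lemma SL_mult_vec_lincomb:
  assumes "g \<in> carrier (SL n)" "u \<in> carrier_vec n" "v \<in> carrier_vec n"
  shows "g *\<^sub>v (a \<cdot>\<^sub>v u + b \<cdot>\<^sub>v v) = a \<cdot>\<^sub>v (g *\<^sub>v u) + b \<cdot>\<^sub>v (g *\<^sub>v v)"
  using SL_carrierD(1)[OF assms(1)] assms(2,3) by (simp add: mult_add_distrib_mat_vec mult_mat_vec)

section \<open>Triviality of the center for odd n\<close>

text \<open>Commuting with the elementary transvections forces \<open>z\<close> to be a scalar
  \<open>c\<close>. The determinant gives \<open>c ^ n = 1\<close>, the order of the multiplicative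
  group gives \<open>c ^ 4 = 1\<close>, and \<open>n\<close> is prime to 4.\<close>

lemma group_center_SL:
  assumes card: "CARD('a::field) = 5" and "odd n"
  shows "group_center (SL n :: 'a mat monoid) = {\<one>\<^bsub>SL n\<^esub>}"
proof -
  interpret group "SL n :: 'a mat monoid" by (rule group_SL)
  have "z = 1\<^sub>m n" if z: "z \<in> group_center (SL n :: 'a mat monoid)" for z
  proof -
    have zc: "z \<in> carrier (SL n)" and comm: "\<And>g. g \<in> carrier (SL n) \<Longrightarrow> g * z = z * g"
      using z by (auto simp: group_center_def mult_SL)
    note zm = SL_carrierD[OF zc]
    \<comment> \<open>Both sides are the image of the basis vector k under
      \<open>?t * z = z * ?t\<close>, where \<open>?t\<close> adds coordinate k to coordinate
      i.\<close>
    have key: "z *\<^sub>v unit_vec n k + z $$ (k,k) \<cdot>\<^sub>v unit_vec n i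
        = z *\<^sub>v unit_vec n k + z *\<^sub>v unit_vec n i" if "i < n" "k < n" "i \<noteq> k" for i k
    proof -
      let ?t = "transvection (unit_vec n i :: 'a vec) k"
      have t: "?t \<in> carrier (SL n)"
        using that by (intro transvection_SL) auto
      have "?t *\<^sub>v (z *\<^sub>v unit_vec n k) = z *\<^sub>v (?t *\<^sub>v unit_vec n k)"
        using comm[OF t] SL_mult_vec[OF t zc] SL_mult_vec[OF zc t] by (metis unit_vec_carrier)
      moreover have "?t *\<^sub>v (z *\<^sub>v unit_vec n k) = z *\<^sub>v unit_vec n k + z $$ (k,k) \<cdot>\<^sub>v unit_vec n i"
        using that zm zc by (subst transvection_mult_vec[of _ n]) auto
      moreover have "z *\<^sub>v (?t *\<^sub>v unit_vec n k) = z *\<^sub>v (unit_vec n k + unit_vec n i)"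
        using that by (subst transvection_mult_vec[of _ n]) auto
      moreover have "\<dots> = z *\<^sub>v unit_vec n k + z *\<^sub>v unit_vec n i"
        using zm by (auto simp: mult_add_distrib_mat_vec)
      ultimately show ?thesis by simp
    qed
    \<comment> \<open>Cancelling \<open>z *\<^sub>v unit_vec n k\<close> in \<open>key\<close> shows
      that column i of \<open>z\<close> is \<open>z $$ (k,k)\<close> times a basis vector.\<close>
    have entry: "z $$ (j, i) = (if j = i then z $$ (k,k) else 0)"
      if "i < n" "k < n" "i \<noteq> k" "j < n" for i j k
      using arg_cong[OF key[OF that(1-3)], of "\<lambda>v. v $ j"] that zm by auto
    define c where "c = z $$ (0,0)"
    have n0: "n > 0" using \<open>odd n\<close> by (auto elim: oddE)
    have z_eq: "z = c \<cdot>\<^sub>m 1\<^sub>m n"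
    proof (rule eq_matI)
      fix i j assume "i < dim_row (c \<cdot>\<^sub>m 1\<^sub>m n)" "j < dim_col (c \<cdot>\<^sub>m 1\<^sub>m n)"
      then have ij: "i < n" "j < n" by auto
      show "z $$ (i,j) = (c \<cdot>\<^sub>m 1\<^sub>m n) $$ (i,j)"
      proof (cases "i = j")
        case True
        then show ?thesis using entry[of i 0 i] ij n0 by (cases "i = 0") (auto simp: c_def)
      next
        case False
        then show ?thesis using entry[of j i i] ij by auto
      qed
    qed (use zm in auto)
    have "det z = c ^ n" unfolding z_eq by simp
    then have cn: "c ^ n = 1" using zm by simp
    then have "c \<noteq> 0" using n0 by (auto simp: power_0_left)
    moreover have "finite (UNIV :: 'a set)" using card by (metis card.infinite zero_neq_numeral)
    ultimately have c4: "c ^ 4 = 1" using field_power_CARD[of c] card by simp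
    obtain m where n: "n = 2 * m + 1" using \<open>odd n\<close> by (rule oddE)
    have "1 = (c ^ n)\<^sup>2" using cn by simp
    also have "\<dots> = (c ^ 4) ^ m * c ^ 2" by (simp add: n algebra_simps flip: power_mult power_add)
    finally have "c ^ 2 = 1" using c4 by simp
    then have "c ^ n = c" unfolding n by (simp add: power_mult)
    then have "c = 1" using cn by simp
    then show ?thesis using z_eq by (simp add: smult_mat_def) (auto intro: eq_matI)
  qed
  moreover have "\<one>\<^bsub>SL n\<^esub> \<in> group_center (SL n :: 'a mat monoid)"
    by (auto simp: group_center_def)
  ultimately show ?thesis by (auto simp: SL_def)
qed

section \<open>Frames and the transitive action on them\<close>

text \<open>Transvections with \<open>k \<ge> 2\<close> fix the first two basis vectors, and two or
  three of them carry the third one to \<open>w\<close>. For n = 3 this would fail, since the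
  determinant would force \<open>w $ 2 = 1\<close>; the fourth coordinate gives the room to change
  that entry.\<close>

lemma SL_transitive_mod_plane:
  fixes w :: "'a::field vec"
  assumes n: "n \<ge> 4" and w: "w \<in> carrier_vec n" and i: "2 \<le> i" "i < n" "w $ i \<noteq> 0"
  shows "\<exists>h\<in>carrier (SL n). h *\<^sub>v unit_vec n 0 = unit_vec n 0
    \<and> h *\<^sub>v unit_vec n 1 = unit_vec n 1 \<and> h *\<^sub>v unit_vec n 2 = w"
proof -
  define H :: "'a mat set" where "H = {h \<in> carrier (SL n). h *\<^sub>v unit_vec n 0 = unit_vec n 0
    \<and> h *\<^sub>v unit_vec n 1 = unit_vec n 1}"
  define R :: "'a vec \<Rightarrow> 'a vec \<Rightarrow> bool" where "R = (\<lambda>x y. \<exists>h\<in>H. h *\<^sub>v x = y)"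
  interpret group "SL n :: 'a mat monoid" by (rule group_SL)
  have trans: "R x z" if xyz: "R x y" "R y z" "x \<in> carrier_vec n" for x y z
  proof -
    obtain g h where gh: "g \<in> H" "h \<in> H" "g *\<^sub>v x = y" "h *\<^sub>v y = z"
      using xyz unfolding R_def by blast
    moreover have "h * g \<in> H"
      using gh m_closed[of h g] by (auto simp: H_def SL_mult_vec mult_SL)
    moreover have "(h * g) *\<^sub>v x = z"
      using gh xyz by (subst SL_mult_vec[of _ n]) (auto simp: H_def)
    ultimately show ?thesis unfolding R_def by blast
  qed
  \<comment> \<open>A single transvection joins two vectors that agree in a nonzero coordinate k:
    its direction is their difference, divided by that coordinate.\<close>
  have step: "R y z" if "k \<ge> 2" "k < n" "y \<in> carrier_vec n" "z \<in> carrier_vec n"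
    "y $ k \<noteq> 0" "z $ k = y $ k" for y z k
  proof -
    define x where "x = (1 / y $ k) \<cdot>\<^sub>v (z - y)"
    have x: "x \<in> carrier_vec n" "x $ k = 0" using that by (auto simp: x_def)
    have "y + y $ k \<cdot>\<^sub>v x = z"
      using that by (intro eq_vecI) (auto simp: x_def)
    then have "transvection x k *\<^sub>v y = z"
      using that x by (simp add: transvection_mult_vec)
    moreover have "transvection x k \<in> H"
    proof -
      have "transvection x k *\<^sub>v unit_vec n j = unit_vec n j" if j: "j < 2" for j
        using \<open>2 \<le> k\<close> \<open>k < n\<close> j x by (auto simp: transvection_mult_vec intro!: eq_vecI)
      then show ?thesis using transvection_SL[OF x(1) \<open>k < n\<close> x(2)] by (auto simp: H_def)
    qed
    ultimately show ?thesis unfolding R_def by blast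
  qed
  have reach: "R (unit_vec n 2) w" if w: "w \<in> carrier_vec n" and i: "2 < i" "i < n" "w $ i \<noteq> 0" for w i
  proof -
    \<comment> \<open>An intermediate vector that shares coordinate 2 with the start and coordinate
      i with the target.\<close>
    let ?w = "vec n (\<lambda>j. if j = 2 then 1 else w $ j)"
    have 1: "R (unit_vec n 2) ?w" using n w by (intro step[of 2]) auto
    have 2: "R ?w w" using n w i by (intro step[of i]) auto
    show ?thesis using 1 2 by (rule trans) auto
  qed
  have "R (unit_vec n 2) w"
  proof (cases "i = 2")
    case False
    then show ?thesis using reach[OF w, of i] i by auto
  next
    case True
    \<comment> \<open>All coordinates of \<open>w\<close> beyond 2 may vanish, so coordinate 3 is
      set to 1 to make \<open>reach\<close> applicable; coordinate 2 then serves for the last step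
      to \<open>w\<close>.\<close>
    let ?w = "vec n (\<lambda>j. if j = 3 then 1 else w $ j)"
    have 1: "R (unit_vec n 2) ?w" using n by (intro reach[of _ 3]) auto
    have 2: "R ?w w" using n w i True by (intro step[of 2]) auto
    show ?thesis using 1 2 by (rule trans) auto
  qed
  then show ?thesis by (auto simp: R_def H_def)
qed

text \<open>Defined as an orbit, so that transitivity is immediate. For \<open>k < n\<close> these
  are exactly the linearly independent \<open>k\<close>-tuples; the parts of this that the counting
  uses are proved below for k = 2 and k = 3.\<close>

definition frames :: "nat \<Rightarrow> nat \<Rightarrow> 'a::field vec list set" where
  "frames n k = (\<lambda>g. map (\<lambda>i. g *\<^sub>v unit_vec n i) [0..<k]) ` carrier (SL n)"

lemma frames_carrier: "s \<in> frames n k \<Longrightarrow> set s \<subseteq> carrier_vec n"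
  by (auto simp: frames_def)

lemma SL_frames:
  assumes "g \<in> carrier (SL n)" "s \<in> frames n k"
  shows "map ((*\<^sub>v) g) s \<in> frames n k"
proof -
  interpret group "SL n :: 'a mat monoid" by (rule group_SL)
  obtain h where h: "h \<in> carrier (SL n)" "s = map (\<lambda>i. h *\<^sub>v unit_vec n i) [0..<k]"
    using assms by (auto simp: frames_def)
  then have "map ((*\<^sub>v) g) s = map (\<lambda>i. (g * h) *\<^sub>v unit_vec n i) [0..<k]"
    using assms by (auto simp: SL_mult_vec)
  moreover have "g * h \<in> carrier (SL n)" using m_closed[OF assms(1) h(1)] by (simp add: mult_SL)
  ultimately show ?thesis by (auto simp: frames_def)
qed

lemma SL_frames_transitive:
  assumes "s \<in> frames n k" "t \<in> frames n k"
  shows "\<exists>g\<in>carrier (SL n). map ((*\<^sub>v) g) s = t"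
proof -
  interpret group "SL n :: 'a mat monoid" by (rule group_SL)
  obtain g h where gh: "g \<in> carrier (SL n)" "s = map (\<lambda>i. g *\<^sub>v unit_vec n i) [0..<k]"
    "h \<in> carrier (SL n)" "t = map (\<lambda>i. h *\<^sub>v unit_vec n i) [0..<k]"
    using assms by (auto simp: frames_def)
  let ?g = "h * inv\<^bsub>SL n\<^esub> g"
  have "?g \<in> carrier (SL n)"
    using m_closed[OF gh(3) SL_inv(1)[OF gh(1)]] by (simp add: mult_SL)
  moreover have "map ((*\<^sub>v) ?g) s = t"
    using gh by (auto simp: SL_mult_vec SL_inv)
  ultimately show ?thesis by blast
qed

lemma finite_SL:
  assumes "finite (UNIV :: 'a::field set)"
  shows "finite (carrier (SL n :: 'a mat monoid))"
  using finite_carrier_mat[OF assms, of n n] by (simp add: SL_def)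

lemma finite_frames:
  assumes "finite (UNIV :: 'a::field set)"
  shows "finite (frames n k :: 'a vec list set)"
  using finite_SL[OF assms] by (simp add: frames_def)

text \<open>The identity as \<open>\<phi>\<close> gives the averages of N2 and N3, and the sign
  change of the third vector gives that of M.\<close>

lemma sum_card_frames:
  fixes \<phi> :: "'a::field vec list \<Rightarrow> 'a vec list"
  assumes "finite (UNIV :: 'a set)" "\<And>s. s \<in> frames n k \<Longrightarrow> \<phi> s \<in> frames n k"
  shows "(\<Sum>g\<in>carrier (SL n). card {s \<in> frames n k. map ((*\<^sub>v) g) s = \<phi> s})
    = card (carrier (SL n :: 'a mat monoid))"
proof -
  interpret group "SL n :: 'a mat monoid" by (rule group_SL)
  show ?thesis
  proof (rule sum_card_transporter)
    show "map ((*\<^sub>v) (g \<otimes>\<^bsub>SL n\<^esub> h)) s = map ((*\<^sub>v) g) (map ((*\<^sub>v) h) s)"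
      if "g \<in> carrier (SL n)" "h \<in> carrier (SL n)" "s \<in> frames n k" for g h and s :: "'a vec list"
      using that frames_carrier[OF that(3)] by (auto simp: mult_SL SL_mult_vec)
    show "frames n k \<noteq> ({} :: 'a vec list set)"
      using one_closed by (auto simp: frames_def)
  qed (use assms finite_SL SL_frames SL_frames_transitive in auto)
qed

lemma frames2_cases: "s \<in> frames n 2 \<Longrightarrow> \<exists>u v. s = [u, v]"
  by (auto simp: frames_def numeral_2_eq_2)

lemma frames3_cases: "s \<in> frames n 3 \<Longrightarrow> \<exists>u v w. s = [u, v, w]"
  by (auto simp: frames_def numeral_3_eq_3)

lemma frames2_iff:
  "[u, v] \<in> frames n 2 \<longleftrightarrow> (\<exists>g\<in>carrier (SL n). u = g *\<^sub>v unit_vec n 0 \<and> v = g *\<^sub>v unit_vec n 1)"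
  by (auto simp: frames_def numeral_2_eq_2)

lemma frames3_iff:
  "[u, v, w] \<in> frames n 3 \<longleftrightarrow> (\<exists>g\<in>carrier (SL n). u = g *\<^sub>v unit_vec n 0
    \<and> v = g *\<^sub>v unit_vec n 1 \<and> w = g *\<^sub>v unit_vec n 2)"
  by (auto simp: frames_def numeral_2_eq_2 numeral_3_eq_3)

lemma frames2_independent:
  assumes "[u, v] \<in> frames n 2" "n \<ge> 2" "a \<cdot>\<^sub>v u + b \<cdot>\<^sub>v v = 0\<^sub>v n"
  shows "a = 0 \<and> b = 0"
proof -
  obtain g where g: "g \<in> carrier (SL n)" "u = g *\<^sub>v unit_vec n 0" "v = g *\<^sub>v unit_vec n 1"
    using assms by (auto simp: frames2_iff)
  define x where "x = a \<cdot>\<^sub>v unit_vec n 0 + b \<cdot>\<^sub>v unit_vec n 1"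
  have x: "x \<in> carrier_vec n" by (simp add: x_def)
  have "g *\<^sub>v x = 0\<^sub>v n"
    unfolding x_def using assms(3) g by (simp add: SL_mult_vec_lincomb)
  moreover have "inv\<^bsub>SL n\<^esub> g *\<^sub>v 0\<^sub>v n = 0\<^sub>v n"
    using SL_carrierD[OF SL_inv(1)[OF g(1)]] by (intro eq_vecI) auto
  ultimately have "x = 0\<^sub>v n" using SL_inv(2)[OF g(1) x] by simp
  then have "x $ 0 = 0" "x $ 1 = 0" using assms(2) by auto
  then show ?thesis using assms(2) by (auto simp: x_def)
qed

lemma frames3_subset2: "[u, v, w] \<in> frames n 3 \<Longrightarrow> [u, v] \<in> frames n 2"
  by (auto simp: frames2_iff frames3_iff)

lemma frames3_notin_plane:
  assumes "[u, v, w] \<in> frames n 3" "n \<ge> 3"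
  shows "w \<noteq> a \<cdot>\<^sub>v u + b \<cdot>\<^sub>v v"
proof
  assume w: "w = a \<cdot>\<^sub>v u + b \<cdot>\<^sub>v v"
  obtain g where g: "g \<in> carrier (SL n)" "u = g *\<^sub>v unit_vec n 0" "v = g *\<^sub>v unit_vec n 1"
    "w = g *\<^sub>v unit_vec n 2"
    using assms by (auto simp: frames3_iff)
  have "g *\<^sub>v unit_vec n 2 = g *\<^sub>v (a \<cdot>\<^sub>v unit_vec n 0 + b \<cdot>\<^sub>v unit_vec n 1)"
    using w g by (simp add: SL_mult_vec_lincomb)
  then have "unit_vec n 2 = a \<cdot>\<^sub>v unit_vec n 0 + b \<cdot>\<^sub>v unit_vec n 1"
    by (metis SL_inv(2)[OF g(1)] add_carrier_vec smult_carrier_vec unit_vec_carrier)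
  then have "(unit_vec n 2 :: 'a vec) $ 2 = (a \<cdot>\<^sub>v unit_vec n 0 + b \<cdot>\<^sub>v unit_vec n 1) $ 2" by simp
  then show False using assms(2) by simp
qed

text \<open>Pull \<open>w\<close> back along a matrix \<open>g\<close> with first columns
  \<open>u\<close>, \<open>v\<close>. The result has a nonzero coordinate beyond the first two, so
  it is the third column of some \<open>h\<close> in SL fixing the first two basis vectors; then
  \<open>g * h\<close> has first columns \<open>u\<close>, \<open>v\<close>,
  \<open>w\<close>.\<close>

lemma frames3_extend:
  assumes uv: "[u, v] \<in> frames n 2" and n: "n \<ge> 4" and w: "w \<in> carrier_vec n"
    and notin: "\<And>a b. w \<noteq> a \<cdot>\<^sub>v u + b \<cdot>\<^sub>v v"
  shows "[u, v, w] \<in> frames n 3"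
proof -
  interpret group "SL n :: 'a mat monoid" by (rule group_SL)
  obtain g where g: "g \<in> carrier (SL n)" "u = g *\<^sub>v unit_vec n 0" "v = g *\<^sub>v unit_vec n 1"
    using uv by (auto simp: frames2_iff)
  define x where "x = inv\<^bsub>SL n\<^esub> g *\<^sub>v w"
  have x: "x \<in> carrier_vec n" "g *\<^sub>v x = w"
    using SL_inv[OF g(1)] w by (auto simp: x_def)
  have "\<exists>i. 2 \<le> i \<and> i < n \<and> x $ i \<noteq> 0"
  proof (rule ccontr)
    assume "\<not> ?thesis"
    then have z: "\<And>i. 2 \<le> i \<Longrightarrow> i < n \<Longrightarrow> x $ i = 0" by blast
    have "x = x $ 0 \<cdot>\<^sub>v unit_vec n 0 + x $ 1 \<cdot>\<^sub>v unit_vec n 1"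
    proof (rule eq_vecI)
      fix i assume "i < dim_vec (x $ 0 \<cdot>\<^sub>v unit_vec n 0 + x $ 1 \<cdot>\<^sub>v unit_vec n 1)"
      then have "i < n" by simp
      moreover have "i = 0 \<or> i = 1 \<or> 2 \<le> i" by linarith
      ultimately show "x $ i = (x $ 0 \<cdot>\<^sub>v unit_vec n 0 + x $ 1 \<cdot>\<^sub>v unit_vec n 1) $ i"
        using n z by auto
    qed (use x in simp)
    then have "w = x $ 0 \<cdot>\<^sub>v u + x $ 1 \<cdot>\<^sub>v v"
      using SL_mult_vec_lincomb[OF g(1)] g x by (metis unit_vec_carrier)
    then show False using notin by blast
  qed
  then obtain h where h: "h \<in> carrier (SL n)" "h *\<^sub>v unit_vec n 0 = unit_vec n 0"
    "h *\<^sub>v unit_vec n 1 = unit_vec n 1" "h *\<^sub>v unit_vec n 2 = x"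
    using SL_transitive_mod_plane[OF n x(1)] by blast
  have "g * h \<in> carrier (SL n)" using m_closed[OF g(1) h(1)] by (simp add: mult_SL)
  then show ?thesis
    unfolding frames3_iff using g h x SL_mult_vec[OF g(1) h(1)] by (intro bexI[of _ "g * h"]) auto
qed

section \<open>The pointwise Bonferroni inequality\<close>

text \<open>A fixed 2-frame can be extended by any of the four nonzero multiples of
  \<open>w\<close>: such a multiple is negated by \<open>a\<close>, hence lies outside the pointwise
  fixed plane because the characteristic is not 2.\<close>

lemma card_fixed_frames2_le_of_neg_eigenvector:
  fixes a :: "'a::field mat"
  assumes card: "CARD('a) = 5" and n: "n \<ge> 4"
    and w: "w \<in> carrier_vec n" "a *\<^sub>v w = - w" "w \<noteq> 0\<^sub>v n" and a: "a \<in> carrier (SL n)"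
  shows "4 * card {s \<in> frames n 2. map ((*\<^sub>v) a) s = s}
    \<le> card {s \<in> frames n 3. map ((*\<^sub>v) a) s = s[2 := - (s ! 2)]}"
proof -
  have fin: "finite (UNIV :: 'a set)" using card by (metis card.infinite zero_neq_numeral)
  have "(5 :: 'a) = 0" using of_nat_CARD[where 'a = 'a] card by simp
  moreover have "(5 :: 'a) = 2 * 2 + 1" by simp
  ultimately have two: "(2 :: 'a) \<noteq> 0" by force
  let ?A = "{s \<in> frames n 2. map ((*\<^sub>v) a) s = s}"
  let ?B = "{s \<in> frames n 3. map ((*\<^sub>v) a) s = s[2 := - (s ! 2)]}"
  let ?f = "\<lambda>(s, c). s @ [c \<cdot>\<^sub>v w]"
  obtain i where i: "i < n" "w $ i \<noteq> 0" using w by (metis carrier_vecD eq_vecI index_zero_vec)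
  have "card (?A \<times> (UNIV - {0::'a})) \<le> card ?B"
  proof (rule card_inj_on_le[of ?f])
    show "inj_on ?f (?A \<times> (UNIV - {0}))"
    proof -
      have "c = d" if "c \<cdot>\<^sub>v w = d \<cdot>\<^sub>v w" for c d
        using arg_cong[OF that, of "\<lambda>x. x $ i"] i w by simp
      then show ?thesis by (auto simp: inj_on_def)
    qed
    show "?f ` (?A \<times> (UNIV - {0})) \<subseteq> ?B"
    proof
      fix t assume "t \<in> ?f ` (?A \<times> (UNIV - {0}))"
      then obtain s c where t: "t = s @ [c \<cdot>\<^sub>v w]" and s: "s \<in> frames n 2" "map ((*\<^sub>v) a) s = s"
        and c: "c \<noteq> 0" by auto
      obtain u v where uv: "s = [u, v]"
        using frames2_cases[OF s(1)] by blast
      then have fix_uv: "a *\<^sub>v u = u" "a *\<^sub>v v = v" "u \<in> carrier_vec n" "v \<in> carrier_vec n"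
        using s frames_carrier[OF s(1)] by auto
      have cw: "a *\<^sub>v (c \<cdot>\<^sub>v w) = - (c \<cdot>\<^sub>v w)"
        using w SL_carrierD[OF a] by (auto simp: mult_mat_vec)
      have "c \<cdot>\<^sub>v w \<noteq> x \<cdot>\<^sub>v u + y \<cdot>\<^sub>v v" for x y
      proof
        assume eq: "c \<cdot>\<^sub>v w = x \<cdot>\<^sub>v u + y \<cdot>\<^sub>v v"
        then have "a *\<^sub>v (c \<cdot>\<^sub>v w) = c \<cdot>\<^sub>v w"
          using fix_uv a by (simp add: SL_mult_vec_lincomb)
        then have "(c \<cdot>\<^sub>v w) $ i = (- (c \<cdot>\<^sub>v w)) $ i" using cw by simp
        then have "2 * (c * w $ i) = 0" using i w by (simp add: eq_neg_iff_add_eq_0 flip: mult_2)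
        then show False using two c i by simp
      qed
      then have "[u, v, c \<cdot>\<^sub>v w] \<in> frames n 3"
        using frames3_extend[of u v n "c \<cdot>\<^sub>v w"] s uv n w by auto
      then show "t \<in> ?B"
        using t uv fix_uv cw by simp
    qed
    show "finite ?B" using finite_frames[OF fin] by simp
  qed
  then show ?thesis using card by (simp add: card_cartesian_product card_Diff_singleton)
qed

text \<open>If \<open>a\<close> has \<open>f\<close> fixed vectors, then it fixes at most \<open>(f - 1)(f - 5)\<close> 2-frames, and each of
  them extends to at least \<open>f - 25\<close> fixed 3-frames. So 480 bounds the number of fixed 2-frames
  unless \<open>f > 25\<close>, and in that case the 3-frames compensate for the excess.\<close>

lemma card_fixed_frames2_le_card_fixed_frames3:
  fixes a :: "'a::field mat"
  assumes card: "CARD('a) = 5" and n: "n \<ge> 4" and a: "a \<in> carrier (SL n)"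
  shows "4 * card {s \<in> frames n 2. map ((*\<^sub>v) a) s = s}
    \<le> 1920 + card {s \<in> frames n 3. map ((*\<^sub>v) a) s = s}"
proof -
  have fin: "finite (UNIV :: 'a set)" using card by (metis card.infinite zero_neq_numeral)
  define F where "F = {x \<in> carrier_vec n. a *\<^sub>v x = x}"
  have finF: "finite F" using finite_carrier_vec[OF fin] by (simp add: F_def)
  let ?A = "{s \<in> frames n 2. map ((*\<^sub>v) a) s = s}"
  let ?B = "{s \<in> frames n 3. map ((*\<^sub>v) a) s = s}"
  have finA: "finite ?A" and finB: "finite ?B" using finite_frames[OF fin] by auto
  have A_cases: "\<exists>u v. s = [u, v] \<and> [u, v] \<in> frames n 2 \<and> u \<in> F \<and> v \<in> F" if "s \<in> ?A" for s
  proof -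
    obtain u v where "s = [u, v]"
      using frames2_cases[of s n] \<open>s \<in> ?A\<close> by blast
    then show ?thesis using that frames_carrier[of s n 2] by (auto simp: F_def)
  qed
  have zero: "0\<^sub>v n \<in> F"
    using SL_carrierD[OF a] by (auto simp: F_def intro!: eq_vecI)
  let ?L = "\<lambda>u. range (\<lambda>c. c \<cdot>\<^sub>v u)"
  have L: "card (?L u) = 5 \<and> ?L u \<subseteq> F" if u: "u \<in> F - {0\<^sub>v n}" for u
  proof -
    have uc: "u \<in> carrier_vec n" "u \<noteq> 0\<^sub>v n" using u by (auto simp: F_def)
    then obtain i where i: "i < n" "u $ i \<noteq> 0" by (metis carrier_vecD eq_vecI index_zero_vec)
    have "inj (\<lambda>c. c \<cdot>\<^sub>v u)"
    proof (rule injI)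
      show "c = d" if "c \<cdot>\<^sub>v u = d \<cdot>\<^sub>v u" for c d
        using arg_cong[OF that, of "\<lambda>x. x $ i"] i uc by simp
    qed
    moreover have "c \<cdot>\<^sub>v u \<in> F" for c
      using u SL_carrierD[OF a] by (auto simp: F_def mult_mat_vec)
    ultimately show ?thesis using card by (auto simp: card_image)
  qed
  have "card ?A \<le> card (SIGMA u:F - {0\<^sub>v n}. F - ?L u)"
  proof (rule surj_card_le[where f = "\<lambda>(u, v). [u, v]"])
    show "finite (SIGMA u:F - {0\<^sub>v n}. F - ?L u)" using finF by auto
    show "?A \<subseteq> (\<lambda>(u, v). [u, v]) ` (SIGMA u:F - {0\<^sub>v n}. F - ?L u)"
    proof
      fix s assume "s \<in> ?A"
      then obtain u v where s: "s = [u, v]" "[u, v] \<in> frames n 2" "u \<in> F" "v \<in> F"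
        using A_cases by blast
      have c: "u \<in> carrier_vec n" "v \<in> carrier_vec n" using s by (auto simp: F_def)
      have "u \<noteq> 0\<^sub>v n"
      proof
        assume "u = 0\<^sub>v n"
        with c have "1 \<cdot>\<^sub>v u + 0 \<cdot>\<^sub>v v = 0\<^sub>v n" by auto
        from frames2_independent[OF s(2) _ this] n show False by simp
      qed
      moreover have "v \<noteq> x \<cdot>\<^sub>v u" for x
      proof
        assume "v = x \<cdot>\<^sub>v u"
        then have "x \<cdot>\<^sub>v u + (- 1) \<cdot>\<^sub>v v = 0\<^sub>v n" using c by auto
        from frames2_independent[OF s(2) _ this] n show False by simp
      qed
      ultimately show "s \<in> (\<lambda>(u, v). [u, v]) ` (SIGMA u:F - {0\<^sub>v n}. F - ?L u)"
        using s by (auto intro!: image_eqI[of _ _ "(u, v)"])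
    qed
  qed
  also have "\<dots> = (\<Sum>u\<in>F - {0\<^sub>v n}. card (F - ?L u))"
    using finF by (simp add: card_SigmaI)
  also have "\<dots> = (\<Sum>u\<in>F - {0\<^sub>v n}. card F - 5)"
    by (rule sum.cong) (use L finF fin in \<open>auto simp: card_Diff_subset finite_subset\<close>)
  also have "\<dots> = (card F - 1) * (card F - 5)"
    using zero finF by (simp add: card_Diff_singleton)
  finally have N2: "card ?A \<le> (card F - 1) * (card F - 5)" .
  let ?P = "\<lambda>s. range (\<lambda>(x, y). x \<cdot>\<^sub>v (s ! 0) + y \<cdot>\<^sub>v (s ! 1))"
  \<comment> \<open>The span of two vectors has at most 25 elements. Truncated subtraction makes the
    bound trivial when \<open>F\<close> has fewer than 25.\<close>
  have P: "card F - 25 \<le> card (F - ?P s)" for s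
  proof -
    have "card (UNIV :: ('a \<times> 'a) set) = 25" using card by (simp add: card_cartesian_product flip: UNIV_Times_UNIV)
    moreover have "finite (UNIV :: ('a \<times> 'a) set)" using fin by (simp add: finite_prod)
    ultimately have "card (?P s) \<le> 25" "finite (?P s)" using card_image_le by (metis, blast)
    then show ?thesis using diff_card_le_card_Diff[of "?P s" F] by linarith
  qed
  have "card ?A * (card F - 25) = (\<Sum>s\<in>?A. card F - 25)" by simp
  also have "\<dots> \<le> (\<Sum>s\<in>?A. card (F - ?P s))" by (rule sum_mono) (rule P)
  also have "\<dots> = card (SIGMA s:?A. F - ?P s)" using finA finF by (simp add: card_SigmaI)
  also have "\<dots> \<le> card ?B"
  proof (rule card_inj_on_le[of "\<lambda>(s, w). s @ [w]"])
    show "(\<lambda>(s, w). s @ [w]) ` (SIGMA s:?A. F - ?P s) \<subseteq> ?B"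
    proof
      fix t assume "t \<in> (\<lambda>(s, w). s @ [w]) ` (SIGMA s:?A. F - ?P s)"
      then obtain s w where t: "t = s @ [w]" "s \<in> ?A" "w \<in> F" "w \<notin> ?P s" by auto
      then obtain u v where s: "s = [u, v]" "[u, v] \<in> frames n 2" "u \<in> F" "v \<in> F"
        using A_cases by blast
      have "w \<noteq> x \<cdot>\<^sub>v u + y \<cdot>\<^sub>v v" for x y using t(4) s(1) by auto
      then have "[u, v, w] \<in> frames n 3"
        using frames3_extend[OF s(2) n] t by (auto simp: F_def)
      then show "t \<in> ?B" using t s by (auto simp: F_def)
    qed
  qed (use finB in \<open>auto simp: inj_on_def\<close>)
  finally have N3: "card ?A * (card F - 25) \<le> card ?B" .
  \<comment> \<open>For \<open>f \<le> 25\<close>, N is at most 24 * 20 = 480. For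
    \<open>f \<ge> 29\<close> already \<open>4 * N \<le> M\<close>. For f = 26, 27, 28 there remain
    3N, 2N, N to bound by 1920, with N at most 525, 572, 621.\<close>
  have ar: "4 * N \<le> 1920 + M" if "N \<le> (f - 1) * (f - 5)" "N * (f - 25) \<le> M" for N M f :: nat
  proof -
    consider "f \<le> 25" | "f = 26" | "f = 27" | "f = 28" | "f \<ge> 29" by linarith
    then show ?thesis
    proof cases
      case 1
      have "(f - 1) * (f - 5) \<le> 24 * 20" by (rule mult_le_mono) (use 1 in auto)
      then show ?thesis using that by linarith
    next
      case 5
      have "N * 4 \<le> N * (f - 25)" by (rule mult_le_mono) (use 5 in auto)
      then show ?thesis using that by linarith
    qed (use that in auto)
  qed
  show ?thesis using N2 N3 by (rule ar)
qed

section \<open>The set and its size\<close>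

text \<open>The fixed plane is given by a basis that is a 2-frame, so its existence says precisely
  that the number of fixed 2-frames is not zero.\<close>

definition fix_plane_no_neg :: "nat \<Rightarrow> 'a::field mat set" where
  "fix_plane_no_neg n = {a \<in> carrier (SL n).
     (\<exists>u v. [u, v] \<in> frames n 2 \<and> a *\<^sub>v u = u \<and> a *\<^sub>v v = v)
   \<and> (\<forall>w\<in>carrier_vec n. a *\<^sub>v w = - w \<longrightarrow> w = 0\<^sub>v n)}"

text \<open>The lower bound for the indicator, multiplied by 1920. Outside the set, either there is
  an eigenvector for -1 and the last term alone suffices, or there is no fixed 2-frame and the left
  side is 0.\<close>

lemma card_fixed_frames2_le:
  fixes a :: "'a::field mat"
  assumes card: "CARD('a) = 5" and n: "n \<ge> 4" and a: "a \<in> carrier (SL n)"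
  shows "4 * card {s \<in> frames n 2. map ((*\<^sub>v) a) s = s}
    \<le> (if a \<in> fix_plane_no_neg n then 1920 else 0) + card {s \<in> frames n 3. map ((*\<^sub>v) a) s = s}
      + card {s \<in> frames n 3. map ((*\<^sub>v) a) s = s[2 := - (s ! 2)]}"
proof (cases "a \<in> fix_plane_no_neg n")
  case True
  then show ?thesis using card_fixed_frames2_le_card_fixed_frames3[OF assms] by simp
next
  case False
  show ?thesis
  proof (cases "\<exists>w\<in>carrier_vec n. a *\<^sub>v w = - w \<and> w \<noteq> 0\<^sub>v n")
    case True
    then show ?thesis using card_fixed_frames2_le_of_neg_eigenvector[OF card n _ _ _ a] False by fastforce
  next
    case no_neg: False
    have "s \<notin> frames n 2 \<or> map ((*\<^sub>v) a) s \<noteq> s" for s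
    proof (rule ccontr)
      assume s: "\<not> ?thesis"
      then obtain u v where "s = [u, v]"
        using frames2_cases by blast
      then show False using s False no_neg a by (auto simp: fix_plane_no_neg_def)
    qed
    then have "{s \<in> frames n 2. map ((*\<^sub>v) a) s = s} = {}" by blast
    then show ?thesis by (simp only: card.empty mult_0_right zero_le)
  qed
qed

text \<open>Makes the sign change an admissible \<open>\<phi>\<close> for the averaging:
  \<open>- w\<close> is outside the plane of \<open>u\<close> and \<open>v\<close> because
  \<open>w\<close> is.\<close>

lemma frames3_neg_third:
  assumes "s \<in> frames n 3" "n \<ge> 4"
  shows "s[2 := - (s ! 2)] \<in> frames n 3"
proof -
  obtain u v w where s: "s = [u, v, w]"
    using frames3_cases[OF assms(1)] by blast
  have c: "u \<in> carrier_vec n" "v \<in> carrier_vec n" "w \<in> carrier_vec n"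
    using frames_carrier[OF assms(1)] s by auto
  have "- w \<noteq> a \<cdot>\<^sub>v u + b \<cdot>\<^sub>v v" for a b
  proof
    assume "- w = a \<cdot>\<^sub>v u + b \<cdot>\<^sub>v v"
    then have "- (- w) = - (a \<cdot>\<^sub>v u + b \<cdot>\<^sub>v v)" by simp
    then have "w = (- a) \<cdot>\<^sub>v u + (- b) \<cdot>\<^sub>v v"
      using c by (auto simp: vec_eq_iff)
    then show False using frames3_notin_plane[of u v w n] assms s by auto
  qed
  then have "[u, v, - w] \<in> frames n 3"
    using frames3_extend[of u v n "- w"] frames3_subset2[of u v w n] assms s c by auto
  then show ?thesis by (simp add: s numeral_2_eq_2)
qed

text \<open>Summed over the group, the pointwise inequality reads 4|G| \<le> 1920|S| + |G| +
  |G|.\<close>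

lemma card_fix_plane_no_neg:
  assumes card: "CARD('a::field) = 5" and n: "n \<ge> 4"
  shows "card (carrier (SL n :: 'a mat monoid)) \<le> 960 * card (fix_plane_no_neg n :: 'a mat set)"
proof -
  let ?G = "carrier (SL n :: 'a mat monoid)"
  let ?S = "fix_plane_no_neg n :: 'a mat set"
  have fin: "finite (UNIV :: 'a set)" using card by (metis card.infinite zero_neq_numeral)
  note finG = finite_SL[OF fin, of n]
  have "4 * card ?G = (\<Sum>a\<in>?G. 4 * card {s \<in> frames n 2. map ((*\<^sub>v) a) s = s})"
    using sum_card_frames[of n 2 "\<lambda>s. s :: 'a vec list"] fin by (simp flip: sum_distrib_left)
  also have "\<dots> \<le> (\<Sum>a\<in>?G. (if a \<in> ?S then 1920 else 0)
      + card {s \<in> frames n 3. map ((*\<^sub>v) a) s = s}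
      + card {s \<in> frames n 3. map ((*\<^sub>v) a) s = s[2 := - (s ! 2)]})"
    by (rule sum_mono) (rule card_fixed_frames2_le[OF card n])
  also have "\<dots> = (\<Sum>a\<in>?G. if a \<in> ?S then 1920 else 0) + card ?G + card ?G"
    by (simp only: sum.distrib sum_card_frames[OF fin, of n 3 "\<lambda>s. s"]
        sum_card_frames[OF fin frames3_neg_third[OF _ n]])
  also have "(\<Sum>a\<in>?G. if a \<in> ?S then 1920 else 0) = 1920 * card ?S"
  proof -
    have "?G \<inter> ?S = ?S" by (auto simp: fix_plane_no_neg_def)
    then show ?thesis using finG by (simp add: sum.If_cases)
  qed
  finally show ?thesis by simp
qed

section \<open>Invariance under conjugation and inversion, and the excluded product\<close>

text \<open>Conjugation by \<open>g\<close> moves the fixed plane by \<open>g\<close>, and an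
  eigenvector of the conjugate for -1 is moved back by the inverse of \<open>g\<close> to one of
  \<open>a\<close>.\<close>

lemma conj_invariant_fix_plane_no_neg:
  "conj_invariant (SL n) (fix_plane_no_neg n :: 'a::field mat set)"
  unfolding conj_invariant_def
proof (intro ballI)
  fix g a :: "'a mat"
  assume g: "g \<in> carrier (SL n)" and a: "a \<in> fix_plane_no_neg n"
  interpret group "SL n :: 'a mat monoid" by (rule group_SL)
  let ?b = "g \<otimes>\<^bsub>SL n\<^esub> a \<otimes>\<^bsub>SL n\<^esub> inv\<^bsub>SL n\<^esub> g"
  have aG: "a \<in> carrier (SL n)" using a by (simp add: fix_plane_no_neg_def)
  have bG: "?b \<in> carrier (SL n)" using g aG by simp
  have b: "?b *\<^sub>v x = g *\<^sub>v (a *\<^sub>v (inv\<^bsub>SL n\<^esub> g *\<^sub>v x))" if "x \<in> carrier_vec n" for x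
    using that g aG m_closed[OF g aG] SL_inv(1)[OF g] by (simp add: mult_SL SL_mult_vec)
  obtain u v where uv: "[u, v] \<in> frames n 2" "a *\<^sub>v u = u" "a *\<^sub>v v = v"
    using a by (auto simp: fix_plane_no_neg_def)
  have c: "u \<in> carrier_vec n" "v \<in> carrier_vec n" using frames_carrier[OF uv(1)] by auto
  have "[g *\<^sub>v u, g *\<^sub>v v] \<in> frames n 2" using SL_frames[OF g uv(1)] by simp
  moreover have "?b *\<^sub>v (g *\<^sub>v u) = g *\<^sub>v u" "?b *\<^sub>v (g *\<^sub>v v) = g *\<^sub>v v"
    using c g uv by (simp_all add: b SL_inv)
  moreover have "w = 0\<^sub>v n" if w: "w \<in> carrier_vec n" "?b *\<^sub>v w = - w" for w
  proof -
    let ?x = "inv\<^bsub>SL n\<^esub> g *\<^sub>v w"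
    have x: "?x \<in> carrier_vec n" using SL_inv(1)[OF g] w by simp
    have neg: "inv\<^bsub>SL n\<^esub> g *\<^sub>v (- w) = - ?x"
      using SL_carrierD[OF SL_inv(1)[OF g]] w by (intro eq_vecI) auto
    have "g *\<^sub>v (a *\<^sub>v ?x) = - w" using b[OF w(1)] w(2) by simp
    then have "inv\<^bsub>SL n\<^esub> g *\<^sub>v (g *\<^sub>v (a *\<^sub>v ?x)) = - ?x" using neg by simp
    then have "a *\<^sub>v ?x = - ?x" using SL_inv(2)[OF g, of "a *\<^sub>v ?x"] aG x by simp
    then have "?x = 0\<^sub>v n" using a x by (auto simp: fix_plane_no_neg_def)
    then have "w = g *\<^sub>v 0\<^sub>v n" using SL_inv(3)[OF g w(1)] by simp
    also have "\<dots> = 0\<^sub>v n" using SL_carrierD[OF g] by (intro eq_vecI) auto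
    finally show ?thesis .
  qed
  ultimately show "?b \<in> fix_plane_no_neg n" using bG by (auto simp: fix_plane_no_neg_def)
qed

text \<open>A matrix and its inverse have the same eigenvectors for 1 and for -1.\<close>

lemma inv_fix_plane_no_neg:
  assumes a: "a \<in> (fix_plane_no_neg n :: 'a::field mat set)"
  shows "inv\<^bsub>SL n\<^esub> a \<in> fix_plane_no_neg n"
proof -
  have aG: "a \<in> carrier (SL n)" using a by (simp add: fix_plane_no_neg_def)
  obtain u v where uv: "[u, v] \<in> frames n 2" "a *\<^sub>v u = u" "a *\<^sub>v v = v"
    using a by (auto simp: fix_plane_no_neg_def)
  have c: "u \<in> carrier_vec n" "v \<in> carrier_vec n" using frames_carrier[OF uv(1)] by auto
  have "inv\<^bsub>SL n\<^esub> a *\<^sub>v u = u" "inv\<^bsub>SL n\<^esub> a *\<^sub>v v = v"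
    using SL_inv(2)[OF aG c(1)] SL_inv(2)[OF aG c(2)] uv by simp_all
  moreover have "w = 0\<^sub>v n" if w: "w \<in> carrier_vec n" "inv\<^bsub>SL n\<^esub> a *\<^sub>v w = - w" for w
  proof -
    have "w = a *\<^sub>v (- w)" using SL_inv(3)[OF aG w(1)] w by simp
    also have "\<dots> = - (a *\<^sub>v w)" using SL_carrierD[OF aG] w by (intro eq_vecI) auto
    finally have "a *\<^sub>v w = - w" by (metis uminus_uminus_vec)
    then show ?thesis using a w by (auto simp: fix_plane_no_neg_def)
  qed
  ultimately show ?thesis using uv SL_inv(1)[OF aG] by (auto simp: fix_plane_no_neg_def)
qed

lemma diag_notin_fix_plane_no_neg_square:
  assumes n: "n \<ge> 2"
  shows "mat_diag n (\<lambda>i. if i = 0 then 1 else - 1 :: 'a::field)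
    \<notin> fix_plane_no_neg n <#>\<^bsub>SL n\<^esub> fix_plane_no_neg n"
proof
  let ?d = "mat_diag n (\<lambda>i. if i = 0 then 1 else - 1 :: 'a)"
  assume "?d \<in> fix_plane_no_neg n <#>\<^bsub>SL n\<^esub> fix_plane_no_neg n"
  then obtain a b where ab: "a \<in> fix_plane_no_neg n" "b \<in> fix_plane_no_neg n" "?d = a * b"
    by (auto simp: set_mult_def mult_SL)
  then have aG: "a \<in> carrier (SL n)" and bG: "b \<in> carrier (SL n)"
    by (auto simp: fix_plane_no_neg_def)
  obtain u v where uv: "[u, v] \<in> frames n 2" "b *\<^sub>v u = u" "b *\<^sub>v v = v"
    using ab by (auto simp: fix_plane_no_neg_def)
  have c: "u \<in> carrier_vec n" "v \<in> carrier_vec n" using frames_carrier[OF uv(1)] by auto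
  \<comment> \<open>Vanishing of the first coordinate is one linear equation on a plane, so it has a
    nontrivial solution.\<close>
  obtain x y where xy: "x \<noteq> 0 \<or> y \<noteq> 0" "x * u $ 0 + y * v $ 0 = 0"
  proof (cases "u $ 0 = 0")
    case True
    then show ?thesis using that[of 1 0] by simp
  next
    case False
    then show ?thesis using that[of "v $ 0" "- u $ 0"] by simp
  qed
  define z where "z = x \<cdot>\<^sub>v u + y \<cdot>\<^sub>v v"
  have z: "z \<in> carrier_vec n" "z $ 0 = 0" using c xy n by (auto simp: z_def)
  have "z \<noteq> 0\<^sub>v n" using frames2_independent[OF uv(1) n] xy unfolding z_def by blast
  moreover have "a *\<^sub>v z = - z"
  proof -
    have "b *\<^sub>v z = z" unfolding z_def using bG c uv by (simp add: SL_mult_vec_lincomb)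
    then have "a *\<^sub>v z = ?d *\<^sub>v z" using SL_mult_vec[OF aG bG z(1)] ab by simp
    \<comment> \<open>The only diagonal entry different from -1 multiplies coordinate 0, where
      \<open>z\<close> vanishes.\<close>
    also have "\<dots> = - z"
    proof (rule eq_vecI)
      fix i assume "i < dim_vec (- z)"
      then have i: "i < n" using z by simp
      have "(?d *\<^sub>v z) $ i = (\<Sum>j\<in>{0..<n}. (if i = j then (if j = 0 then 1 else - 1) else 0) * z $ j)"
        using i z by (simp add: mat_diag_def scalar_prod_def)
      also have "\<dots> = (\<Sum>j\<in>{0..<n}. if j = i then (if i = 0 then 1 else - 1) * z $ i else 0)"
        by (rule sum.cong) auto
      finally show "(?d *\<^sub>v z) $ i = (- z) $ i" using i z by auto
    qed (use z in \<open>simp add: mat_diag_def\<close>)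
    finally show ?thesis .
  qed
  ultimately show False using ab(1) z(1) by (simp add: fix_plane_no_neg_def)
qed

text \<open>The first conjunct expresses SL = PSL: the quotient map by the center is an isomorphism.
  The diagonal matrix has determinant 1 because n - 1 is even, so it is an element of the group that
  the product set misses.\<close>

theorem theorem1p6:
  fixes n :: nat
  assumes "CARD('a) = 5"
    and "odd n"
    and "n \<ge> 5"
  shows "(\<lambda>A. group_center (SL n) #>\<^bsub>SL n\<^esub> A) \<in> iso (SL n :: 'a::field mat monoid) (PSL n)
    \<and> (\<exists>S \<subseteq> carrier (SL n :: 'a mat monoid).
          conj_invariant (SL n) S
        \<and> set_inv\<^bsub>SL n\<^esub> S = S
        \<and> real (card S) \<ge> real (card (carrier (SL n :: 'a mat monoid))) / 960
        \<and> mat_diag n (\<lambda>i. if i = 0 then 1 else - 1) \<notin> S <#>\<^bsub>SL n\<^esub> S)"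
proof (intro conjI exI[of _ "fix_plane_no_neg n"])
  interpret group "SL n :: 'a mat monoid" by (rule group_SL)
  let ?S = "fix_plane_no_neg n :: 'a mat set"
  show "(\<lambda>A. group_center (SL n) #>\<^bsub>SL n\<^esub> A) \<in> iso (SL n :: 'a mat monoid) (PSL n)"
    unfolding PSL_def group_center_SL[OF assms(1,2)] by (rule trivial_quotient_iso)
  show sub: "?S \<subseteq> carrier (SL n)" by (auto simp: fix_plane_no_neg_def)
  show "conj_invariant (SL n) ?S" by (rule conj_invariant_fix_plane_no_neg)
  show "set_inv\<^bsub>SL n\<^esub> ?S = ?S"
  proof
    show "set_inv\<^bsub>SL n\<^esub> ?S \<subseteq> ?S" by (auto simp: SET_INV_def inv_fix_plane_no_neg)
    show "?S \<subseteq> set_inv\<^bsub>SL n\<^esub> ?S"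
    proof
      fix a assume a: "a \<in> ?S"
      then have "a = inv\<^bsub>SL n\<^esub> (inv\<^bsub>SL n\<^esub> a)" using sub by auto
      then show "a \<in> set_inv\<^bsub>SL n\<^esub> ?S"
        unfolding SET_INV_def using inv_fix_plane_no_neg[OF a] by blast
    qed
  qed
  have "real (card (carrier (SL n :: 'a mat monoid))) \<le> real (960 * card ?S)"
    using card_fix_plane_no_neg[OF assms(1), of n] assms(3) by (intro of_nat_mono) simp
  then show "real (card ?S) \<ge> real (card (carrier (SL n :: 'a mat monoid))) / 960" by simp
  show "mat_diag n (\<lambda>i. if i = 0 then 1 else - 1) \<notin> ?S <#>\<^bsub>SL n\<^esub> ?S"
    by (rule diag_notin_fix_plane_no_neg_square) (use assms(3) in simp)
qed

end
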